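(* Let $n_1\geq n_2\geq 1$ be integers. Then $$\mathcal{C}_N(S^{n_1}\times S^{n_2})\leq\sqrt{\frac{2n_2+1}{n_2+1}}\qquad\text{for all } N\geq (n_1+1)(n_2+1)+\frac{n_2(n_2+3)}{2}.$$
   Context: $\mathbb{B}^N\subset\mathbb{R}^N$ denotes the closed unit ball. For a smooth immersion $f:X\to\mathbb{B}^N$ with (vector-valued) second fundamental form $\mathbf{A}$ in $\mathbb{R}^N$, the maximal normal curvature is $\mathfrak{c}(f):=\sup_{|u|=1}|\mathbf{A}(u,u)|$, the supremum being over all tangent vectors $u$ to $X$ of unit length with respect to the pullback metric $g=f^*g_{\mathbb{R}^N}$. The minimal curvature invariant is $\mathcal{C}_N(X):=\inf\mathfrak{c}(f)$, the infimum being over all smooth immersions $f:X\to\mathbb{B}^N$. *)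

theory Defs
  imports "HOL-Analysis.Analysis"
begin

text \<open>
  Manifolds are represented as embedded smooth submanifolds \<open>X\<close> of a Euclidean space, with the
  induced smooth structure.  All notions below depend only on the restriction to \<open>X\<close> of the maps
  involved.
\<close>

(* C^k in terms of iterated directional derivatives; meaningful for open S. *)
primrec ck_on :: "nat \<Rightarrow> 'a::real_normed_vector set \<Rightarrow> ('a \<Rightarrow> 'b::real_normed_vector) \<Rightarrow> bool" where
  "ck_on 0 S f \<longleftrightarrow> continuous_on S f"
| "ck_on (Suc k) S f \<longleftrightarrow>
     (\<forall>x\<in>S. f differentiable (at x)) \<and> (\<forall>v. ck_on k S (\<lambda>x. frechet_derivative f (at x) v))"

definition smooth_on :: "'a::real_normed_vector set \<Rightarrow> ('a \<Rightarrow> 'b::real_normed_vector) \<Rightarrow> bool" where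
  "smooth_on S f \<longleftrightarrow> (\<forall>k. ck_on k S f)"

(* A map on a submanifold is smooth iff it extends smoothly, locally, to the ambient space. *)
definition smooth_map :: "'a::euclidean_space set \<Rightarrow> ('a \<Rightarrow> 'b::euclidean_space) \<Rightarrow> bool" where
  "smooth_map X f \<longleftrightarrow>
     (\<forall>p\<in>X. \<exists>U F. open U \<and> p \<in> U \<and> smooth_on U F \<and> (\<forall>x\<in>X \<inter> U. F x = f x))"

definition smooth_curve_at ::
    "'a::euclidean_space set \<Rightarrow> 'a \<Rightarrow> 'a \<Rightarrow> (real \<Rightarrow> 'a) \<Rightarrow> bool" where
  "smooth_curve_at X p u \<gamma> \<longleftrightarrow>
     (\<exists>e>0. smooth_on {-e<..<e} \<gamma> \<and> \<gamma> ` {-e<..<e} \<subseteq> X) \<and>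
     \<gamma> 0 = p \<and> (\<gamma> has_vector_derivative u) (at 0)"

definition tangent_space :: "'a::euclidean_space set \<Rightarrow> 'a \<Rightarrow> 'a set" where
  "tangent_space X p = {u. \<exists>\<gamma>. smooth_curve_at X p u \<gamma>}"

(* Only meaningful for p in X and u tangent to X at p. *)
definition differential ::
    "'a::euclidean_space set \<Rightarrow> ('a \<Rightarrow> 'b::euclidean_space) \<Rightarrow> 'a \<Rightarrow> 'a \<Rightarrow> 'b" where
  "differential X f p u =
     (THE w. \<forall>\<gamma>. smooth_curve_at X p u \<gamma> \<longrightarrow> ((f \<circ> \<gamma>) has_vector_derivative w) (at 0))"

definition smooth_immersion ::
    "'a::euclidean_space set \<Rightarrow> ('a \<Rightarrow> 'b::euclidean_space) \<Rightarrow> bool" where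
  "smooth_immersion X f \<longleftrightarrow>
     smooth_map X f \<and> (\<forall>p\<in>X. inj_on (differential X f p) (tangent_space X p))"

definition normal_part :: "'a::euclidean_space set \<Rightarrow> 'a \<Rightarrow> 'a" where
  "normal_part W y = (THE z. z \<in> orthogonal_comp W \<and> y - z \<in> W)"

definition tangent_field :: "'a::euclidean_space set \<Rightarrow> ('a \<Rightarrow> 'a) \<Rightarrow> bool" where
  "tangent_field X V \<longleftrightarrow> smooth_map X V \<and> (\<forall>x\<in>X. V x \<in> tangent_space X x)"

(* A(u,v) is the component normal to f of the flat derivative, in direction u, of the field df(V)
   along f, where V is any tangent field on X extending v; the result does not depend on V. *)
definition second_fundamental_form ::
    "'a::euclidean_space set \<Rightarrow> ('a \<Rightarrow> 'b::euclidean_space) \<Rightarrow> 'a \<Rightarrow> 'a \<Rightarrow> 'a \<Rightarrow> 'b" where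
  "second_fundamental_form X f p u v =
     (THE w. \<forall>V. tangent_field X V \<and> V p = v \<longrightarrow>
        w = normal_part (differential X f p ` tangent_space X p)
              (differential X (\<lambda>x. differential X f x (V x)) p u))"

(* The length of u in the pullback metric is the norm of df(u).  Values are taken in ennreal, so
   that an unbounded supremum, or the infimum when there is no immersion, is infinite. *)
definition max_normal_curvature ::
    "'a::euclidean_space set \<Rightarrow> ('a \<Rightarrow> 'b::euclidean_space) \<Rightarrow> ennreal" where
  "max_normal_curvature X f =
     (SUP (p, u) \<in> {(p, u). p \<in> X \<and> u \<in> tangent_space X p \<and> norm (differential X f p u) = 1}.
        ennreal (norm (second_fundamental_form X f p u u)))"

(* The target is the closed unit ball of real^'n, that is, N = CARD('n). *)
definition minimal_curvature :: "'n::finite itself \<Rightarrow> 'a::euclidean_space set \<Rightarrow> ennreal" where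
  "minimal_curvature _ X =
     (INF f \<in> {f :: 'a \<Rightarrow> real^'n. smooth_immersion X f \<and> f ` X \<subseteq> cball 0 1}.
        max_normal_curvature X f)"

end

theory Submission
  imports Defs
begin

text \<open>
  With \<open>n = n2\<close> and \<open>c\<^sup>2 = (n + 1) / (2 n + 1)\<close>, the map
  \<open>f (x, y) = c (x \<otimes> y, y \<otimes> y - I / (n + 1))\<close> takes values in the unit sphere of the
  product of the spaces of all matrices and of traceless symmetric matrices, whose dimension is
  the required bound on \<open>N\<close>.  It is quadratic up to a constant, and its pullback metric is \<open>c\<^sup>2 (\<bar>u\<bar>\<^sup>2 + 3 \<bar>v\<bar>\<^sup>2)\<close>.  Products of
  great circles are geodesics for this metric, so the normal curvature in direction \<open>(u, v)\<close> is the
  length of the second derivative of \<open>f\<close> along such a curve, namely \<open>c (\<bar>u\<bar>\<^sup>2 + 3 \<bar>v\<bar>\<^sup>2)\<close>.  This is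
  constantly \<open>1 / c\<close> on unit vectors.
\<close>

section \<open>Smooth maps and differentials\<close>

lemma ck_on_cong:
  assumes "open S" "\<And>x. x \<in> S \<Longrightarrow> f x = g x" "ck_on k S f"
  shows "ck_on k S g"
  using assms(2,3)
proof (induction k arbitrary: f g)
  case 0
  then show ?case using continuous_on_eq by fastforce
next
  case (Suc k)
  have d: "(f has_derivative frechet_derivative f (at x)) (at x)" if "x \<in> S" for x
    using Suc.prems(2) that unfolding ck_on.simps frechet_derivative_works by blast
  have *: "(g has_derivative frechet_derivative f (at x)) (at x)" if "x \<in> S" for x
    using d[OF that] \<open>open S\<close> that Suc.prems(1) by (rule has_derivative_transform_within_open)
  have "ck_on k S (\<lambda>x. frechet_derivative g (at x) v)" for v
  proof (rule Suc.IH)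
    show "ck_on k S (\<lambda>x. frechet_derivative f (at x) v)"
      using Suc.prems(2) unfolding ck_on.simps by blast
    show "frechet_derivative f (at x) v = frechet_derivative g (at x) v" if "x \<in> S" for x
      using frechet_derivative_at[OF *[OF that]] by simp
  qed
  with * show ?case unfolding ck_on.simps differentiable_def by blast
qed

text \<open>Smoothness can be read off any explicit derivative: derivatives are unique, so
  \<open>f'\<close> agrees with \<open>frechet_derivative f\<close> on \<open>S\<close> and
  \<open>ck_on_cong\<close> transfers the order.\<close>

lemma ck_on_SucI:
  assumes "open S" "\<And>x. x \<in> S \<Longrightarrow> (f has_derivative f' x) (at x)"
    and "\<And>v. ck_on k S (\<lambda>x. f' x v)"
  shows "ck_on (Suc k) S f"
proof -
  have "f' x v = frechet_derivative f (at x) v" if "x \<in> S" for x v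
    using frechet_derivative_at[OF assms(2)[OF that]] by simp
  then have "ck_on k S (\<lambda>x. frechet_derivative f (at x) v)" for v
    by (rule ck_on_cong[OF assms(1) _ assms(3)])
  then show ?thesis
    using assms(2) unfolding ck_on.simps differentiable_def by blast
qed

lemma ck_on_Suc_has_derivative:
  assumes "ck_on (Suc k) S f" "x \<in> S"
  shows "(f has_derivative frechet_derivative f (at x)) (at x)"
  using assms unfolding ck_on.simps frechet_derivative_works by blast

lemma ck_on_SucD: "ck_on (Suc k) S f \<Longrightarrow> ck_on k S f"
proof (induction k arbitrary: f)
  case 0
  then show ?case
    by (simp add: differentiable_at_imp_differentiable_on differentiable_imp_continuous_on)
next
  case (Suc k)
  show ?case
    unfolding ck_on.simps(2)[of k]
  proof (intro conjI allI)
    show "\<forall>x\<in>S. f differentiable at x"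
      using Suc.prems unfolding ck_on.simps(2)[of "Suc k"] by blast
    show "ck_on k S (\<lambda>x. frechet_derivative f (at x) v)" for v
      using Suc.prems unfolding ck_on.simps(2)[of "Suc k"] by (blast intro: Suc.IH)
  qed
qed

lemma ck_on_const: "open S \<Longrightarrow> ck_on k S (\<lambda>x. c)"
proof (induction k arbitrary: c)
  case (Suc k)
  then show ?case by (auto intro!: ck_on_SucI derivative_eq_intros)
qed simp

lemma ck_on_ident: "open S \<Longrightarrow> ck_on k S (\<lambda>x. x)"
proof (cases k)
  case (Suc k)
  assume "open S" then show ?thesis unfolding Suc by (auto intro!: ck_on_SucI ck_on_const has_derivative_ident)
qed simp

lemma ck_on_add:
  assumes "open S"
  shows "ck_on k S f \<Longrightarrow> ck_on k S g \<Longrightarrow> ck_on k S (\<lambda>x. f x + g x)"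
proof (induction k arbitrary: f g)
  case 0
  then show ?case by (simp add: continuous_on_add)
next
  case (Suc k)
  show ?case
  proof (rule ck_on_SucI[OF assms])
    show "((\<lambda>x. f x + g x) has_derivative
        (\<lambda>v. frechet_derivative f (at x) v + frechet_derivative g (at x) v)) (at x)" if "x \<in> S" for x
      using Suc.prems that by (intro has_derivative_add ck_on_Suc_has_derivative)
    show "ck_on k S (\<lambda>x. frechet_derivative f (at x) v + frechet_derivative g (at x) v)" for v
      using Suc.prems by (intro Suc.IH) simp_all
  qed
qed

lemma (in bounded_bilinear) ck_on_prod:
  assumes "open S"
  shows "ck_on k S f \<Longrightarrow> ck_on k S g \<Longrightarrow> ck_on k S (\<lambda>x. prod (f x) (g x))"
proof (induction k arbitrary: f g)
  case 0
  then show ?case by (simp add: continuous_on)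
next
  case (Suc k)
  show ?case
  proof (rule ck_on_SucI[OF assms])
    show "((\<lambda>x. prod (f x) (g x)) has_derivative
        (\<lambda>v. prod (f x) (frechet_derivative g (at x) v) + prod (frechet_derivative f (at x) v) (g x)))
        (at x)" if "x \<in> S" for x
      using Suc.prems that by (intro FDERIV ck_on_Suc_has_derivative)
    show "ck_on k S (\<lambda>x. prod (f x) (frechet_derivative g (at x) v)
        + prod (frechet_derivative f (at x) v) (g x))" for v
      \<comment> \<open>Each Leibniz term keeps one factor undifferentiated;
        \<open>ck_on_SucD\<close> lowers that factor to order \<open>k\<close>.\<close>
      using Suc.prems[THEN ck_on_SucD] Suc.prems[unfolded ck_on.simps]
      by (intro ck_on_add[OF assms] Suc.IH) blast+
  qed
qed

lemma smooth_on_quadratic: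
  "bounded_bilinear q \<Longrightarrow> open S \<Longrightarrow> smooth_on S (\<lambda>z. q z z + c)"
  unfolding smooth_on_def
  by (intro allI ck_on_add ck_on_const bounded_bilinear.ck_on_prod[of q] ck_on_ident)

lemma has_derivative_trig:
  fixes c d :: "'a::real_normed_vector"
  shows "((\<lambda>t. cos (w * t) *\<^sub>R c + sin (w * t) *\<^sub>R d) has_derivative
     (\<lambda>v. cos (w * t) *\<^sub>R (v * w) *\<^sub>R d + sin (w * t) *\<^sub>R - (v * w) *\<^sub>R c)) (at t)"
  by (auto intro!: derivative_eq_intros simp: algebra_simps)

text \<open>Differentiation maps this family to itself and only changes the coefficients, so the
  induction runs over all \<open>c\<close> and \<open>d\<close>.\<close>

lemma ck_on_trig:
  fixes c d :: "'a::real_normed_vector"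
  assumes "open S"
  shows "ck_on k S (\<lambda>t. cos (w * t) *\<^sub>R c + sin (w * t) *\<^sub>R d)"
proof (induction k arbitrary: c d)
  case 0
  show ?case by (auto intro!: continuous_intros)
next
  case (Suc k)
  from ck_on_SucI[OF assms has_derivative_trig Suc.IH] show ?case .
qed

section \<open>Differentials and normal parts, computed from local extensions\<close>

lemma smooth_on_imp_has_derivative:
  assumes "smooth_on S f" "x \<in> S"
  shows "(f has_derivative frechet_derivative f (at x)) (at x)"
  using assms unfolding smooth_on_def by (blast intro: ck_on_Suc_has_derivative)

lemma smooth_curve_at_comp:
  assumes \<gamma>: "smooth_curve_at X p u \<gamma>"
    and "open U" "p \<in> U" "\<And>x. x \<in> X \<inter> U \<Longrightarrow> F x = f x"
    and F: "(F has_derivative F') (at p)"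
  shows "((f \<circ> \<gamma>) has_vector_derivative F' u) (at 0)"
proof -
  obtain e where e: "e > 0" "smooth_on {-e<..<e} \<gamma>" "\<gamma> ` {-e<..<e} \<subseteq> X"
    and \<gamma>0: "\<gamma> 0 = p" and \<gamma>': "(\<gamma> has_vector_derivative u) (at 0)"
    using \<gamma> unfolding smooth_curve_at_def by blast
  \<comment> \<open>Continuity keeps \<open>\<gamma>\<close> inside \<open>U\<close> for times near
    0, where \<open>F\<close> and \<open>f\<close> agree along the curve.\<close>
  have "ck_on 0 {-e<..<e} \<gamma>" using e(2) unfolding smooth_on_def by blast
  then have "open ({-e<..<e} \<inter> \<gamma> -` U)"
    using \<open>open U\<close> by (intro continuous_open_preimage) auto
  moreover have "(F \<circ> \<gamma> has_vector_derivative F' u) (at 0)"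
  proof -
    have "(F \<circ> \<gamma> has_derivative F' \<circ> (\<lambda>t. t *\<^sub>R u)) (at 0)"
      using \<gamma>' F \<gamma>0 unfolding has_vector_derivative_def by (intro diff_chain_at) auto
    moreover have "F' \<circ> (\<lambda>t. t *\<^sub>R u) = (\<lambda>t. t *\<^sub>R F' u)"
      using has_derivative_linear[OF F] by (auto simp: linear_cmul)
    ultimately show ?thesis unfolding has_vector_derivative_def by simp
  qed
  ultimately show ?thesis
    using e \<gamma>0 assms(3,4)
    by (elim has_vector_derivative_transform_within_open) auto
qed

text \<open>By the chain rule every curve with velocity \<open>u\<close> yields the same derivative,
  and tangency of \<open>u\<close> supplies at least one such curve, so the definite description is
  determined.\<close>

lemma differential_eq:
  assumes "u \<in> tangent_space X p"
    and "open U" "p \<in> U" "\<And>x. x \<in> X \<inter> U \<Longrightarrow> F x = f x"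
    and "(F has_derivative F') (at p)"
  shows "differential X f p u = F' u"
proof -
  obtain \<gamma> where \<gamma>: "smooth_curve_at X p u \<gamma>"
    using assms(1) unfolding tangent_space_def by blast
  show ?thesis
    unfolding differential_def
  proof (rule the_equality)
    fix w assume "\<forall>\<gamma>. smooth_curve_at X p u \<gamma> \<longrightarrow> ((f \<circ> \<gamma>) has_vector_derivative w) (at 0)"
    with \<gamma> have "((f \<circ> \<gamma>) has_vector_derivative w) (at 0)" by blast
    with smooth_curve_at_comp[OF \<gamma> assms(2-5)] show "w = F' u"
      by (blast intro: vector_derivative_unique_at)
  qed (use smooth_curve_at_comp assms in blast)
qed

text \<open>Differentiates an equation that holds only on \<open>X\<close>: near \<open>p\<close>,
  both \<open>F\<close> and the constant \<open>c\<close> extend the same map on \<open>X\<close>,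
  hence give the same differential. It is applied below to the sphere equations and to the tangency
  condition.\<close>

lemma derivative_eq_0_of_const:
  fixes F :: "'a::euclidean_space \<Rightarrow> 'b::euclidean_space"
  assumes "u \<in> tangent_space X p"
    and "open U" "p \<in> U" "\<And>x. x \<in> X \<inter> U \<Longrightarrow> F x = c"
    and "(F has_derivative F') (at p)"
  shows "F' u = 0"
  using differential_eq[OF assms(1-3), of F "\<lambda>_. c" F']
    differential_eq[OF assms(1-3), of "\<lambda>_. c" "\<lambda>_. c" "\<lambda>_. 0"] assms(4,5) by auto

text \<open>Two candidates differ by a vector lying both in \<open>W\<close> and in its orthogonal
  complement, hence orthogonal to itself.\<close>

lemma normal_part_eq:
  assumes "subspace W" "z \<in> orthogonal_comp W" "y - z \<in> W"
  shows "normal_part W y = z"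
  unfolding normal_part_def
proof (rule the_equality)
  fix z' assume z': "z' \<in> orthogonal_comp W \<and> y - z' \<in> W"
  have "(y - z) - (y - z') \<in> W" using assms z' by (blast intro: subspace_diff)
  then have "z' - z \<in> W" by simp
  moreover have "z' - z \<in> orthogonal_comp W"
    using assms z' subspace_orthogonal_comp by (blast intro: subspace_diff)
  ultimately have "inner (z' - z) (z' - z) = 0"
    unfolding orthogonal_comp_def orthogonal_def by blast
  then show "z' = z" by simp
qed (use assms in auto)

section \<open>Quadratic maps\<close>

context
  fixes q :: "'a::euclidean_space \<Rightarrow> 'a \<Rightarrow> 'b::euclidean_space"
  assumes q: "bounded_bilinear q"
begin

interpretation bounded_bilinear q by (fact q)

text \<open>Both orders of the arguments are kept because the form used later, built from
  \<open>segre_veronese\<close>, is not symmetric.\<close>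

lemma has_derivative_quadratic:
  "((\<lambda>z. q z z + c) has_derivative (\<lambda>h. q z h + q h z)) (at z)"
  using has_derivative_add[OF FDERIV[OF has_derivative_ident has_derivative_ident] has_derivative_const]
  by simp

lemma differential_quadratic:
  assumes "u \<in> tangent_space X p"
  shows "differential X (\<lambda>z. q z z + c) p u = q p u + q u p"
  using assms has_derivative_quadratic by (intro differential_eq[of _ _ _ UNIV]) auto

lemma smooth_map_quadratic: "smooth_map X (\<lambda>z. q z z + c)"
  unfolding smooth_map_def using smooth_on_quadratic[OF q open_UNIV] by blast

text \<open>The field is differentiable only through a local extension \<open>Vt\<close>; the map
  \<open>q x (Vt x) + q (Vt x) x\<close> then extends \<open>df(V)\<close> and the product rule
  applies to it.\<close>

lemma differential_differential_quadratic:
  assumes "u \<in> tangent_space X p" "p \<in> X" "\<And>x. x \<in> X \<Longrightarrow> V x \<in> tangent_space X x"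
    and "open U" "p \<in> U" "\<And>x. x \<in> X \<inter> U \<Longrightarrow> Vt x = V x"
    and "(Vt has_derivative V') (at p)"
  shows "differential X (\<lambda>x. differential X (\<lambda>z. q z z + c) x (V x)) p u
       = q u (V p) + q (V p) u + (q p (V' u) + q (V' u) p)"
proof -
  have "differential X (\<lambda>x. differential X (\<lambda>z. q z z + c) x (V x)) p u
     = (\<lambda>h. (q p (V' h) + q h (Vt p)) + (q (Vt p) h + q (V' h) p)) u"
  proof (rule differential_eq[OF assms(1,4,5), of "\<lambda>x. q x (Vt x) + q (Vt x) x"])
    show "((\<lambda>x. q x (Vt x) + q (Vt x) x) has_derivative
        (\<lambda>h. (q p (V' h) + q h (Vt p)) + (q (Vt p) h + q (V' h) p))) (at p)"
      by (intro has_derivative_add FDERIV has_derivative_ident assms(7))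
  qed (use assms in \<open>simp add: differential_quadratic\<close>)
  then show ?thesis using assms by (simp add: algebra_simps)
qed

end

section \<open>Traceless symmetric matrices\<close>

definition sym_traceless :: "(real^'n^'n) set" where
  "sym_traceless = {A. transpose A = A \<and> trace A = 0}"

lemma subspace_symmetric: "subspace {A :: real^'n^'n. transpose A = A}"
  by (auto simp: subspace_def transpose_def vec_eq_iff)

lemma subspace_sym_traceless: "subspace (sym_traceless :: (real^'n^'n) set)"
  by (auto simp: sym_traceless_def subspace_def transpose_def vec_eq_iff trace_def sum.distrib
      simp flip: sum_distrib_left)

lemma dim_symmetric_le:
  "dim {A :: real^'n^'n. transpose A = A} \<le> CARD('n) + (CARD('n) choose 2)"
proof -
  \<comment> \<open>Unordered index pairs: singletons are diagonal positions, two-element sets are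
    mirrored off-diagonal ones. The indicator matrices \<open>E S\<close> span the symmetric
    matrices.\<close>
  define P :: "'n set set" where "P = {S. card S = 1} \<union> {S. card S = 2}"
  define E :: "'n set \<Rightarrow> real^'n^'n" where "E S = (\<chi> i j. of_bool ({i, j} = S))" for S
  have fin: "finite P" by simp
  have "card P = card {S :: 'n set. card S = 1} + card {S :: 'n set. card S = 2}"
    unfolding P_def by (rule card_Un_disjoint) auto
  then have cardP: "card P = CARD('n) + (CARD('n) choose 2)"
    using n_subsets[of "UNIV :: 'n set"] by simp
  have "A \<in> span (E ` P)" if A: "transpose A = A" for A :: "real^'n^'n"
  proof -
    have sym: "A $ i $ j = A $ j $ i" for i j
      using A by (metis transpose_def vec_lambda_beta)
    \<comment> \<open>The common entry of \<open>A\<close> at the mirrored positions given by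
      \<open>S\<close>; symmetry makes the choice unique.\<close>
    define a where "a S = (SOME r. \<exists>i j. S = {i, j} \<and> r = A $ i $ j)" for S
    have a: "a {i, j} = A $ i $ j" for i j
      unfolding a_def using sym by (intro some_equality) (auto simp: doubleton_eq_iff)
    have P: "{i, j} \<in> P" for i j
      by (cases "i = j") (auto simp: P_def)
    have "(\<Sum>S\<in>P. a S * of_bool ({i, j} = S)) = (\<Sum>S\<in>P. if {i, j} = S then a S else 0)" for i j
      by (intro sum.cong) auto
    then have "A = (\<Sum>S\<in>P. a S *\<^sub>R E S)"
      using P fin by (simp add: vec_eq_iff E_def a)
    also have "\<dots> \<in> span (E ` P)"
      by (intro span_sum span_scale span_base) auto
    finally show ?thesis .
  qed
  then have "dim {A :: real^'n^'n. transpose A = A} \<le> card (E ` P)"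
    using fin by (intro dim_le_card) auto
  also have "\<dots> \<le> card P" by (rule card_image_le[OF fin])
  finally show ?thesis using cardP by simp
qed

text \<open>The identity matrix is symmetric with nonzero trace, so the trace condition costs a
  dimension. This strictness is what makes the bound on \<open>N\<close> sharp enough.\<close>

lemma dim_sym_traceless_less:
  "dim (sym_traceless :: (real^'n^'n) set) < CARD('n) + (CARD('n) choose 2)"
proof -
  have "sym_traceless \<subset> {A :: real^'n^'n. transpose A = A}"
  proof
    show "sym_traceless \<subseteq> {A :: real^'n^'n. transpose A = A}"
      by (auto simp: sym_traceless_def)
    have "mat 1 \<in> {A :: real^'n^'n. transpose A = A} - sym_traceless"
      by (simp add: sym_traceless_def transpose_mat trace_I)
    then show "sym_traceless \<noteq> {A :: real^'n^'n. transpose A = A}" by blast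
  qed
  then have "dim (sym_traceless :: (real^'n^'n) set) < dim {A :: real^'n^'n. transpose A = A}"
    by (intro dim_psubset)
      (simp only: span_eq_iff[THEN iffD2, OF subspace_symmetric]
        span_eq_iff[THEN iffD2, OF subspace_sym_traceless])
  with dim_symmetric_le show ?thesis by (rule less_le_trans[rotated])
qed

section \<open>Outer products\<close>

definition outer :: "real^'m \<Rightarrow> real^'k \<Rightarrow> real^'k^'m" where
  "outer x y = (\<chi> i j. x $ i * y $ j)"

lemma bilinear_outer: "bilinear outer"
  by (auto simp: bilinear_def outer_def vec_eq_iff algebra_simps intro!: linearI)

text \<open>The tensor product pairing; the metric, norm and orthogonality computations for the
  immersion all reduce to it.\<close>

lemma inner_outer: "inner (outer x y) (outer x' y') = inner x x' * inner y y'"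
  by (simp add: inner_vec_def outer_def sum_product) (simp add: mult_ac)

lemma inner_mat_1_outer: "inner (mat 1) (outer x y) = inner x y"
  by (simp add: inner_vec_def outer_def mat_def if_distrib[of "\<lambda>c. c * _"] cong: if_cong)

lemma inner_mat_1_mat_1: "inner (mat 1 :: real^'n^'n) (mat 1) = real CARD('n)"
  by (simp add: inner_vec_def mat_def if_distrib[of "\<lambda>c. c * _"] cong: if_cong)

lemma trace_outer: "trace (outer x y) = inner x y"
  by (simp add: trace_def outer_def inner_vec_def)

section \<open>Products of two spheres\<close>

abbreviation (input) sphere_prod :: "('a::euclidean_space \<times> 'b::euclidean_space) set" where
  "sphere_prod \<equiv> sphere 0 1 \<times> sphere 0 1"

lemma mem_sphere_prod:
  "p \<in> sphere_prod \<longleftrightarrow> inner (fst p) (fst p) = 1 \<and> inner (snd p) (snd p) = 1"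
  by (cases p) (simp add: norm_eq_1)

lemma bounded_bilinear_inner_fst:
  "bounded_bilinear (\<lambda>z z'. inner (fst z) (fst z'))"
  and bounded_bilinear_inner_snd:
  "bounded_bilinear (\<lambda>z z'. inner (snd z) (snd z'))"
  using bounded_bilinear.comp[OF bounded_bilinear_inner bounded_linear_fst bounded_linear_fst]
    bounded_bilinear.comp[OF bounded_bilinear_inner bounded_linear_snd bounded_linear_snd]
  by auto

lemma great_circle:
  fixes x u :: "'a::euclidean_space"
  assumes "inner x x = 1" "inner u x = 0"
  defines "\<gamma> \<equiv> \<lambda>t. cos (norm u * t) *\<^sub>R x + sin (norm u * t) *\<^sub>R sgn u"
  shows "norm (\<gamma> t) = 1" "(\<gamma> has_vector_derivative u) (at 0)"
proof -
  have orth: "inner x (sgn u) = 0" "inner (sgn u) x = 0"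
    using assms(2) by (simp_all add: sgn_div_norm inner_commute)
  have "inner (\<gamma> t) (\<gamma> t) = (cos (norm u * t))\<^sup>2 + (sin (norm u * t))\<^sup>2 * (norm (sgn u))\<^sup>2"
    unfolding \<gamma>_def
    by (simp add: assms(1) orth inner_add_left inner_add_right dot_square_norm[of "sgn u"] power2_eq_square)
  \<comment> \<open>For \<open>u = 0\<close> both \<open>norm u\<close> and \<open>sgn u\<close>
    vanish and the curve rests at \<open>x\<close>; otherwise \<open>sgn u\<close> is a unit
    vector.\<close>
  then have "inner (\<gamma> t) (\<gamma> t) = 1"
    by (cases "u = 0") (simp_all add: norm_sgn)
  then show "norm (\<gamma> t) = 1" by (simp only: norm_eq_1)
  have "(v * norm u) *\<^sub>R sgn u = v *\<^sub>R u" for v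
    by (cases "u = 0") (simp_all add: sgn_div_norm)
  then show "(\<gamma> has_vector_derivative u) (at 0)"
    unfolding \<gamma>_def has_vector_derivative_def
    using has_derivative_trig[of "norm u" x "sgn u" 0] by simp
qed

text \<open>One inclusion differentiates the two sphere equations; for the other, a product of great
  circles realises each admissible velocity.\<close>

lemma tangent_space_sphere_prod:
  assumes p: "p \<in> sphere_prod"
  shows "tangent_space sphere_prod p = {u. inner (fst u) (fst p) = 0 \<and> inner (snd u) (snd p) = 0}"
proof (intro set_eqI iffI)
  fix u assume u: "u \<in> tangent_space sphere_prod p"
  have "inner (fst p) (fst u) + inner (fst u) (fst p) = 0"
    by (rule derivative_eq_0_of_const[OF u open_UNIV UNIV_I _
          bounded_bilinear.FDERIV[OF bounded_bilinear_inner_fst has_derivative_ident has_derivative_ident]])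
      (auto simp: mem_sphere_prod dot_square_norm)
  moreover have "inner (snd p) (snd u) + inner (snd u) (snd p) = 0"
    by (rule derivative_eq_0_of_const[OF u open_UNIV UNIV_I _
          bounded_bilinear.FDERIV[OF bounded_bilinear_inner_snd has_derivative_ident has_derivative_ident]])
      (auto simp: mem_sphere_prod dot_square_norm)
  ultimately show "u \<in> {u. inner (fst u) (fst p) = 0 \<and> inner (snd u) (snd p) = 0}"
    by (simp add: inner_commute)
next
  fix u assume "u \<in> {u. inner (fst u) (fst p) = 0 \<and> inner (snd u) (snd p) = 0}"
  then have u: "inner (fst u) (fst p) = 0" "inner (snd u) (snd p) = 0" by auto
  define g1 where "g1 t = cos (norm (fst u) * t) *\<^sub>R fst p + sin (norm (fst u) * t) *\<^sub>R sgn (fst u)" for t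
  define g2 where "g2 t = cos (norm (snd u) * t) *\<^sub>R snd p + sin (norm (snd u) * t) *\<^sub>R sgn (snd u)" for t
  have g1: "norm (g1 t) = 1" "(g1 has_vector_derivative fst u) (at 0)" for t
    using great_circle[of "fst p" "fst u"] p u unfolding g1_def mem_sphere_prod by blast+
  have g2: "norm (g2 t) = 1" "(g2 has_vector_derivative snd u) (at 0)" for t
    using great_circle[of "snd p" "snd u"] p u unfolding g2_def mem_sphere_prod by blast+
  let ?\<gamma> = "\<lambda>t. (g1 t, g2 t)"
  \<comment> \<open>As a sum of two trigonometric curves in the product space, the pair falls under
    \<open>ck_on_add\<close> and \<open>ck_on_trig\<close>.\<close>
  have "?\<gamma> = (\<lambda>t. (cos (norm (fst u) * t) *\<^sub>R (fst p, 0) + sin (norm (fst u) * t) *\<^sub>R (sgn (fst u), 0))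
    + (cos (norm (snd u) * t) *\<^sub>R (0, snd p) + sin (norm (snd u) * t) *\<^sub>R (0, sgn (snd u))))"
    by (simp add: fun_eq_iff g1_def g2_def)
  then have "smooth_on {-1<..<1} ?\<gamma>"
    unfolding smooth_on_def by (simp only:) (intro allI ck_on_add ck_on_trig open_greaterThanLessThan)
  moreover have "?\<gamma> ` {-1<..<1} \<subseteq> sphere_prod"
    using g1 g2 by auto
  moreover have "?\<gamma> 0 = p" by (simp add: g1_def g2_def)
  moreover have "(?\<gamma> has_vector_derivative u) (at 0)"
    using has_vector_derivative_Pair[OF g1(2) g2(2)] by simp
  ultimately have "smooth_curve_at sphere_prod p u ?\<gamma>"
    unfolding smooth_curve_at_def by (intro conjI exI[of _ "1::real"]) auto
  then show "u \<in> tangent_space sphere_prod p"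
    unfolding tangent_space_def by blast
qed

lemma subspace_tangent_space_sphere_prod:
  "p \<in> sphere_prod \<Longrightarrow> subspace (tangent_space sphere_prod p)"
  by (auto simp: tangent_space_sphere_prod subspace_def inner_add)

text \<open>Ensures that the condition defining \<open>second_fundamental_form\<close> is not
  vacuous, so that it determines a unique value.\<close>

lemma tangent_field_extension:
  fixes p u :: "'a::euclidean_space \<times> 'b::euclidean_space"
  assumes p: "p \<in> sphere_prod" and u: "u \<in> tangent_space sphere_prod p"
  obtains V where "tangent_field sphere_prod V" "V p = u"
proof
  \<comment> \<open>On the product of spheres, \<open>T z z + u\<close> is the orthogonal projection
    of the constant vector \<open>u\<close> to the tangent space at \<open>z\<close>. Being
    quadratic plus a constant, it is smooth.\<close>
  define T where "T z z' = - (inner (fst u) (fst z) *\<^sub>R fst z', inner (snd u) (snd z) *\<^sub>R snd z')"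
    for z z' :: "'a \<times> 'b"
  have "bilinear T"
    by (simp add: bilinear_def T_def linear_iff inner_add_right scaleR_add_left scaleR_add_right)
  then have "bounded_bilinear T" by (simp add: bilinear_conv_bounded_bilinear)
  from smooth_map_quadratic[OF this]
  show "tangent_field sphere_prod (\<lambda>z. T z z + u)"
    unfolding tangent_field_def
    by (auto simp: tangent_space_sphere_prod T_def inner_diff_left norm_eq_1)
  show "T p p + u = u"
    using u p by (auto simp: tangent_space_sphere_prod T_def prod_eq_iff)
qed

context
  fixes q :: "'a::euclidean_space \<times> 'b::euclidean_space \<Rightarrow> 'a \<times> 'b \<Rightarrow> 'c::euclidean_space"
  assumes q: "bounded_bilinear q"
begin

interpretation bounded_bilinear q by (fact q)

text \<open>
  The vector \<open>- m\<close> is the acceleration of the product of two great circles with velocity \<open>u\<close>, and \<open>w\<close>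
  is the second derivative of the quadratic map along this curve.
\<close>
lemma second_fundamental_form_quadratic:
  fixes p u :: "'a \<times> 'b"
  assumes p: "p \<in> sphere_prod" and u: "u \<in> tangent_space sphere_prod p"
  defines "m \<equiv> (inner (fst u) (fst u) *\<^sub>R fst p, inner (snd u) (snd u) *\<^sub>R snd p)"
  defines "w \<equiv> 2 *\<^sub>R q u u - (q p m + q m p)"
  assumes orth: "\<And>v. v \<in> tangent_space sphere_prod p \<Longrightarrow> inner w (q p v + q v p) = 0"
  shows "second_fundamental_form sphere_prod (\<lambda>z. q z z + c) p u u = w"
proof -
  let ?X = "sphere_prod :: ('a \<times> 'b) set"
  let ?T = "tangent_space ?X p"
  let ?f = "\<lambda>z. q z z + c"
  have lin: "linear (\<lambda>v. q p v + q v p)"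
    by (intro bounded_linear.linear bounded_linear_add bounded_linear_right bounded_linear_left)
  have im: "differential ?X ?f p ` ?T = (\<lambda>v. q p v + q v p) ` ?T"
    using differential_quadratic[OF q] by (rule image_cong[OF refl])
  have sub: "subspace (differential ?X ?f p ` ?T)"
    unfolding im by (intro linear_subspace_image lin subspace_tangent_space_sphere_prod p)
  have orth': "w \<in> orthogonal_comp (differential ?X ?f p ` ?T)"
    unfolding im orthogonal_comp_def orthogonal_def using orth by (auto simp only: inner_commute[of _ w])
  have normal: "normal_part (differential ?X ?f p ` ?T)
      (differential ?X (\<lambda>x. differential ?X ?f x (V x)) p u) = w"
    if V: "tangent_field ?X V" "V p = u" for V
  proof -
    have VT: "V x \<in> tangent_space ?X x" if "x \<in> ?X" for x
      using V(1) that unfolding tangent_field_def by (elim conjE bspec)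
    obtain U Vt where U: "open U" "p \<in> U" "smooth_on U Vt" "\<And>x. x \<in> ?X \<inter> U \<Longrightarrow> Vt x = V x"
      using V(1) p unfolding tangent_field_def smooth_map_def by (elim conjE ballE[of _ _ p]) auto
    obtain V' where V': "(Vt has_derivative V') (at p)"
      using smooth_on_imp_has_derivative[OF U(3,2)] ..
    have Vp: "Vt p = u" using U(4)[of p] U(2) V(2) p by simp
    have VT': "inner (fst (Vt x)) (fst x) = 0" "inner (snd (Vt x)) (snd x) = 0"
      if "x \<in> ?X \<inter> U" for x
      using VT[of x] U(4)[OF that] that tangent_space_sphere_prod[of x] by auto
    \<comment> \<open>Differentiating the tangency relations \<open>VT'\<close> along
      \<open>u\<close> fixes the radial components of \<open>V' u\<close>: they are minus the
      squared lengths of the components of \<open>u\<close>.\<close>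
    have "inner (fst (Vt p)) (fst u) + inner (fst (V' u)) (fst p) = 0"
      using VT'(1) by (rule derivative_eq_0_of_const[OF u U(1,2) _
            bounded_bilinear.FDERIV[OF bounded_bilinear_inner_fst V' has_derivative_ident]])
    moreover have "inner (snd (Vt p)) (snd u) + inner (snd (V' u)) (snd p) = 0"
      using VT'(2) by (rule derivative_eq_0_of_const[OF u U(1,2) _
            bounded_bilinear.FDERIV[OF bounded_bilinear_inner_snd V' has_derivative_ident]])
    moreover have "inner (fst p) (fst p) = 1" "inner (snd p) (snd p) = 1"
      using p unfolding mem_sphere_prod by auto
    \<comment> \<open>Adding \<open>m\<close> cancels exactly these radial components.\<close>
    ultimately have tan: "V' u + m \<in> ?T"
      unfolding tangent_space_sphere_prod[OF p] Vp m_def by (simp add: inner_add_left)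
    have "differential ?X (\<lambda>x. differential ?X ?f x (V x)) p u
        = q u (V p) + q (V p) u + (q p (V' u) + q (V' u) p)"
      by (rule differential_differential_quadratic[OF q u p VT U(1,2,4) V'])
    \<comment> \<open>The derivative of \<open>df(V)\<close> differs from \<open>w\<close> by the
      image of the tangent vector \<open>V' u + m\<close>, so the choice of \<open>V\<close> does
      not affect the normal part.\<close>
    then have "differential ?X (\<lambda>x. differential ?X ?f x (V x)) p u - w = q p (V' u + m) + q (V' u + m) p"
      unfolding w_def V(2) add_left add_right scaleR_2 by (simp only: algebra_simps)
    with tan have "differential ?X (\<lambda>x. differential ?X ?f x (V x)) p u - w
        \<in> differential ?X ?f p ` ?T"
      unfolding im by simp
    then show ?thesis by (rule normal_part_eq[OF sub orth'])
  qed
  obtain V where "tangent_field ?X V" "V p = u"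
    using tangent_field_extension[OF p u] .
  with normal show ?thesis
    unfolding second_fundamental_form_def by (intro the_equality) blast+
qed

end
section \<open>The immersion\<close>

text \<open>On the diagonal this is the Segre map \<open>x \<otimes> y\<close> paired with the
  Veronese map \<open>y \<otimes> y\<close>.\<close>

definition segre_veronese :: "(real^'a) \<times> (real^'b) \<Rightarrow> (real^'a) \<times> (real^'b) \<Rightarrow> (real^'b^'a) \<times> (real^'b^'b)" where
  "segre_veronese z z' = (outer (fst z) (snd z'), outer (snd z) (snd z'))"

lemma bilinear_segre_veronese: "bilinear segre_veronese"
  by (simp add: bilinear_def segre_veronese_def linear_iff bilinear_ladd[OF bilinear_outer]
      bilinear_radd[OF bilinear_outer] bilinear_lmul[OF bilinear_outer] bilinear_rmul[OF bilinear_outer])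

text \<open>Polarisation, carried out inside \<open>W\<close> because \<open>L\<close> preserves
  norms only there.\<close>

lemma norm_linear_isometry_on_imp_inner:
  fixes L :: "'a::real_inner \<Rightarrow> 'b::real_inner"
  assumes "linear L" "subspace W" "\<And>x. x \<in> W \<Longrightarrow> norm (L x) = norm x" "x \<in> W" "y \<in> W"
  shows "inner (L x) (L y) = inner x y"
  using assms subspace_add[OF assms(2,4,5)]
  by (simp add: dot_norm linear_add[symmetric])

lemma obtain_isometry_sym_traceless:
  assumes "CARD('a) * CARD('b) + (CARD('b) + (CARD('b) choose 2)) \<le> CARD('n) + 1"
  obtains L :: "(real^'b^'a) \<times> (real^'b^'b) \<Rightarrow> real^'n"
  where "linear L" "\<And>x. x \<in> UNIV \<times> sym_traceless \<Longrightarrow> norm (L x) = norm x"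
proof -
  have "dim ((UNIV :: (real^'b^'a) set) \<times> (sym_traceless :: (real^'b^'b) set))
      = CARD('a) * CARD('b) + dim (sym_traceless :: (real^'b^'b) set)"
    by (simp add: dim_Times subspace_sym_traceless)
  \<comment> \<open>The \<open>+ 1\<close> in the assumption is absorbed by the strict inequality
    for traceless matrices.\<close>
  also have "\<dots> \<le> dim (UNIV :: (real^'n) set)"
    using assms dim_sym_traceless_less[where 'n='b] by simp
  finally have "dim ((UNIV :: (real^'b^'a) set) \<times> (sym_traceless :: (real^'b^'b) set))
      \<le> dim (UNIV :: (real^'n) set)" .
  from isometry_subset_subspace[OF subspace_Times[OF subspace_UNIV subspace_sym_traceless] subspace_UNIV this] that
  show thesis by metis
qed

lemma sym_traceless_symmetrized_outer:
  "inner x y = 0 \<Longrightarrow> outer x y + outer y x \<in> sym_traceless"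
  unfolding sym_traceless_def
  by (simp add: trace_add trace_outer inner_commute) (simp add: transpose_def vec_eq_iff outer_def)

text \<open>The trace of \<open>outer y y\<close> is 1, so this shift moves the Veronese part into
  the space where the embedding is isometric.\<close>

lemma outer_diff_mat_1_sym_traceless:
  fixes y :: "real^'b"
  shows "inner y y = 1 \<Longrightarrow> outer y y - (1 / real CARD('b)) *\<^sub>R mat 1 \<in> sym_traceless"
  by (simp add: sym_traceless_def trace_def transpose_def vec_eq_iff outer_def mat_def mult.commute
      sum_subtractf inner_vec_def)

section \<open>Pullback metric and curvature of the immersion\<close>

context
  fixes L :: "(real^'b^'a) \<times> (real^'b^'b) \<Rightarrow> real^'n" and c :: real
  assumes L: "linear L" and iso: "\<And>x. x \<in> UNIV \<times> sym_traceless \<Longrightarrow> norm (L x) = norm x"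
    and c: "c > 0" and c2: "c\<^sup>2 = real CARD('b) / real (2 * CARD('b) - 1)"
begin

definition quad_form :: "(real^'a) \<times> (real^'b) \<Rightarrow> (real^'a) \<times> (real^'b) \<Rightarrow> real^'n" where
  "quad_form z z' = c *\<^sub>R L (segre_veronese z z')"

definition quad_map :: "(real^'a) \<times> (real^'b) \<Rightarrow> real^'n" where
  "quad_map z = quad_form z z + c *\<^sub>R L (0, - (1 / real CARD('b)) *\<^sub>R mat 1)"

lemma bounded_bilinear_quad_form: "bounded_bilinear quad_form"
  unfolding bilinear_conv_bounded_bilinear[symmetric] bilinear_def linear_iff quad_form_def
  by (simp only: bilinear_ladd[OF bilinear_segre_veronese] bilinear_radd[OF bilinear_segre_veronese]
      bilinear_lmul[OF bilinear_segre_veronese] bilinear_rmul[OF bilinear_segre_veronese]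
      linear_add[OF L] linear_cmul[OF L] scaleR_add_right scaleR_left_commute[of c] simp_thms)

lemma inner_L: "x \<in> UNIV \<times> sym_traceless \<Longrightarrow> y \<in> UNIV \<times> sym_traceless \<Longrightarrow> inner (L x) (L y) = inner x y"
  by (rule norm_linear_isometry_on_imp_inner[OF L subspace_Times[OF subspace_UNIV subspace_sym_traceless] iso])

lemma norm_quad_map:
  assumes "p \<in> sphere_prod"
  shows "norm (quad_map p) = 1"
proof -
  let ?n = "real CARD('b)"
  obtain x y where p: "p = (x, y)" by fastforce
  have xy: "inner x x = 1" "inner y y = 1" using assms by (simp_all add: p norm_eq_1)
  define M where "M = (outer x y, outer y y - (1 / ?n) *\<^sub>R mat 1)"
  have M: "M \<in> UNIV \<times> sym_traceless"
    using outer_diff_mat_1_sym_traceless[OF xy(2)] by (simp add: M_def)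
  have "quad_map p = c *\<^sub>R L M"
    unfolding quad_map_def quad_form_def segre_veronese_def M_def p
    by (simp add: scaleR_add_right[symmetric] linear_add[OF L, symmetric])
  then have "inner (quad_map p) (quad_map p) = c\<^sup>2 * inner M M"
    using inner_L[OF M M] by (simp add: power2_eq_square)
  also have "inner M M = 1 + (1 - 2 / ?n + (1 / ?n)\<^sup>2 * ?n)"
  proof -
    have "inner (outer y y) (mat 1) = 1"
      using inner_mat_1_outer[of y y] xy(2) by (simp only: inner_commute)
    then show ?thesis
      by (simp add: M_def inner_diff_left inner_diff_right inner_outer xy inner_mat_1_outer
          inner_mat_1_mat_1 power2_eq_square)
  qed
  finally have normsq: "inner (quad_map p) (quad_map p) = c\<^sup>2 * (1 + (1 - 2 / ?n + (1 / ?n)\<^sup>2 * ?n))" .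
  have "?n \<ge> 1" by (simp add: Suc_leI)
  then have "2 * ?n - 1 \<noteq> 0" "?n \<noteq> 0" by linarith+
  \<comment> \<open>The bracket is \<open>2 - 1 / ?n = (2 * ?n - 1) / ?n\<close>, the reciprocal of
    \<open>c\<^sup>2\<close>; this dictates the choice of \<open>c\<close>.\<close>
  then have "c\<^sup>2 * (1 + (1 - 2 / ?n + (1 / ?n)\<^sup>2 * ?n)) = 1"
    unfolding c2 by (simp add: of_nat_diff Suc_leI divide_simps power2_eq_square)
  with normsq show ?thesis by (simp only: norm_eq_1)
qed

lemma
  assumes p: "(x, y) \<in> sphere_prod" and u: "(u, v) \<in> tangent_space sphere_prod (x, y)"
  defines "dq \<equiv> quad_form (x, y) (u, v) + quad_form (u, v) (x, y)"
  shows quad_form_tangent: "dq = c *\<^sub>R L (outer x v + outer u y, outer y v + outer v y)"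
    and quad_form_tangent_mem: "(outer x v + outer u y, outer y v + outer v y) \<in> UNIV \<times> sym_traceless"
    and norm_quad_form_tangent: "(norm dq)\<^sup>2 = c\<^sup>2 * ((norm u)\<^sup>2 + 3 * (norm v)\<^sup>2)"
proof -
  let ?M = "(outer x v + outer u y, outer y v + outer v y)"
  have xy: "inner x x = 1" "inner y y = 1" using p by (simp_all add: norm_eq_1)
  have uv: "inner x u = 0" "inner u x = 0" "inner v y = 0" "inner y v = 0"
    using u unfolding tangent_space_sphere_prod[OF p] by (simp_all add: inner_commute)
  show dq: "dq = c *\<^sub>R L ?M"
    unfolding dq_def quad_form_def segre_veronese_def
    by (simp add: scaleR_add_right[symmetric] linear_add[OF L, symmetric])
  show M: "?M \<in> UNIV \<times> sym_traceless"
    using sym_traceless_symmetrized_outer[OF uv(4)] by simp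
  have "(norm dq)\<^sup>2 = c\<^sup>2 * inner ?M ?M"
    unfolding dq power2_norm_eq_inner using inner_L[OF M M]
    by (simp only: inner_scaleR_left inner_scaleR_right power2_eq_square mult.assoc)
  \<comment> \<open>The Segre component contributes \<open>inner u u + inner v v\<close>, the
    Veronese component \<open>2 * inner v v\<close>; the cross terms vanish by tangency.\<close>
  also have "inner ?M ?M = inner u u + 3 * inner v v"
    by (simp add: inner_add_left inner_add_right inner_outer xy uv)
  finally show "(norm dq)\<^sup>2 = c\<^sup>2 * ((norm u)\<^sup>2 + 3 * (norm v)\<^sup>2)"
    by (simp add: power2_norm_eq_inner)
qed

text \<open>The pullback metric is positive definite, so the differential has trivial kernel on each
  tangent space.\<close>

lemma smooth_immersion_quad_map: "smooth_immersion sphere_prod quad_map"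
  unfolding smooth_immersion_def
proof (intro conjI ballI)
  have eq: "quad_map = (\<lambda>z. quad_form z z + c *\<^sub>R L (0, - (1 / real CARD('b)) *\<^sub>R mat 1))"
    by (rule ext) (rule quad_map_def)
  show "smooth_map sphere_prod quad_map"
    unfolding eq by (rule smooth_map_quadratic[OF bounded_bilinear_quad_form])
  fix p :: "(real^'a) \<times> (real^'b)" assume p: "p \<in> sphere_prod"
  interpret bounded_bilinear quad_form by (rule bounded_bilinear_quad_form)
  let ?d = "\<lambda>w. quad_form p w + quad_form w p"
  have lin: "linear ?d"
    by (intro bounded_linear.linear bounded_linear_add bounded_linear_right bounded_linear_left)
  have "w = 0" if "w \<in> tangent_space sphere_prod p" "?d w = 0" for w
  proof -
    obtain x y u v where xy: "p = (x, y)" and uv: "w = (u, v)" by (metis surj_pair)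
    have "c\<^sup>2 * ((norm u)\<^sup>2 + 3 * (norm v)\<^sup>2) = 0"
      using norm_quad_form_tangent[of x y u v] p that unfolding xy uv by simp
    then have "(norm u)\<^sup>2 + 3 * (norm v)\<^sup>2 = 0" using c by simp
    then have "(norm u)\<^sup>2 = 0" "(norm v)\<^sup>2 = 0"
      using zero_le_power2[of "norm u"] zero_le_power2[of "norm v"] by linarith+
    then show ?thesis by (simp add: uv zero_prod_def)
  qed
  then have "inj_on ?d (tangent_space sphere_prod p)"
    unfolding linear_injective_on_subspace_0[OF lin subspace_tangent_space_sphere_prod[OF p]]
    by simp
  moreover have "differential sphere_prod quad_map p w = ?d w" if "w \<in> tangent_space sphere_prod p" for w
    unfolding eq by (rule differential_quadratic[OF bounded_bilinear_quad_form that])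
  ultimately show "inj_on (differential sphere_prod quad_map p) (tangent_space sphere_prod p)"
    by (simp only: inj_on_cong[of "tangent_space sphere_prod p" "differential sphere_prod quad_map p" ?d])
qed

lemma second_fundamental_form_quad_map:
  assumes p: "p \<in> sphere_prod" and w: "w \<in> tangent_space sphere_prod p"
    and nw: "norm (differential sphere_prod quad_map p w) = 1"
  shows "norm (second_fundamental_form sphere_prod quad_map p w w) = 1 / c"
proof -
  obtain x y u v where xy: "p = (x, y)" and uv: "w = (u, v)" by (metis surj_pair)
  interpret bounded_bilinear quad_form by (rule bounded_bilinear_quad_form)
  have eq: "quad_map = (\<lambda>z. quad_form z z + c *\<^sub>R L (0, - (1 / real CARD('b)) *\<^sub>R mat 1))"
    by (rule ext) (rule quad_map_def)
  have ip: "inner x x = 1" "inner y y = 1" using p by (simp_all add: xy norm_eq_1)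
  have iw: "inner x u = 0" "inner u x = 0" "inner v y = 0" "inner y v = 0"
    using w unfolding uv xy tangent_space_sphere_prod[OF p[unfolded xy]] by (simp_all add: inner_commute)
  define s where "s = inner u u"
  define t where "t = inner v v"
  \<comment> \<open>The second derivative along the product of great circles, before applying
    \<open>c\<close> and \<open>L\<close>.\<close>
  let ?N = "(2 *\<^sub>R outer u v - (s + t) *\<^sub>R outer x y, 2 *\<^sub>R outer v v - (2 * t) *\<^sub>R outer y y)"
  let ?m = "(s *\<^sub>R x, t *\<^sub>R y)"
  have outer_scale: "outer (r *\<^sub>R a) b = r *\<^sub>R outer a b" "outer a (r *\<^sub>R b) = r *\<^sub>R outer a b"
    for r and a :: "real^'k" and b :: "real^'l"
    by (simp_all add: outer_def vec_eq_iff)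
  \<comment> \<open>The trace of the second component is \<open>2 * t - 2 * t\<close>, as
    \<open>y\<close> is a unit vector.\<close>
  have N: "?N \<in> UNIV \<times> sym_traceless"
    using ip by (auto simp: sym_traceless_def trace_def transpose_def outer_def vec_eq_iff t_def
        inner_vec_def sum_subtractf mult.commute simp flip: sum_distrib_left sum_distrib_right)
  have wN: "2 *\<^sub>R quad_form w w - (quad_form p ?m + quad_form ?m p) = c *\<^sub>R L ?N"
  proof -
    have "?N = 2 *\<^sub>R segre_veronese w w - (segre_veronese p ?m + segre_veronese ?m p)"
      unfolding segre_veronese_def xy uv mult_2 scaleR_add_left
      by (simp add: outer_scale add.commute)
    then show ?thesis
      unfolding quad_form_def
      by (simp add: linear_diff[OF L] linear_add[OF L] linear_cmul[OF L] scaleR_add_right scaleR_diff_right)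
  qed
  have "second_fundamental_form sphere_prod quad_map p w w = 2 *\<^sub>R quad_form w w - (quad_form p ?m + quad_form ?m p)"
  proof -
    have "inner (c *\<^sub>R L ?N) (quad_form p w' + quad_form w' p) = 0"
      if w': "w' \<in> tangent_space sphere_prod p" for w'
    proof -
      obtain u' v' where uv': "w' = (u', v')" by (metis surj_pair)
      let ?M = "(outer x v' + outer u' y, outer y v' + outer v' y)"
      have p': "(x, y) \<in> sphere_prod" "(u', v') \<in> tangent_space sphere_prod (x, y)"
        using p w' unfolding xy uv' by auto
      have iw': "inner x u' = 0" "inner y v' = 0"
        using p'(2) unfolding tangent_space_sphere_prod[OF p'(1)] by (simp_all add: inner_commute)
      \<comment> \<open>By \<open>inner_outer\<close>, every term contains a pairing of
        \<open>x\<close> or \<open>y\<close> with a vector tangent to its sphere.\<close>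
      have "inner ?N ?M = 0"
        by (simp add: inner_diff_left inner_add_right inner_outer iw iw' ip)
      then show ?thesis
        using inner_L[OF N quad_form_tangent_mem[OF p']] quad_form_tangent[OF p']
        unfolding xy uv' by simp
    qed
    then show ?thesis
      unfolding eq
      using second_fundamental_form_quadratic[OF bounded_bilinear_quad_form p w,
          of "c *\<^sub>R L (0, - (1 / real CARD('b)) *\<^sub>R mat 1)"]
      unfolding wN[symmetric] by (simp add: xy uv s_def t_def)
  qed
  then have "(norm (second_fundamental_form sphere_prod quad_map p w w))\<^sup>2 = c\<^sup>2 * inner ?N ?N"
    unfolding wN power2_norm_eq_inner using inner_L[OF N N]
    by (simp only: inner_scaleR_left inner_scaleR_right power2_eq_square mult.assoc)
  \<comment> \<open>The components contribute \<open>4 * s * t + (s + t)\<^sup>2\<close> and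
    \<open>8 * t\<^sup>2\<close>, which add up to a perfect square: the curvature is thus
    proportional to the pullback metric.\<close>
  also have "inner ?N ?N = (s + 3 * t)\<^sup>2"
    by (simp add: inner_diff_left inner_diff_right inner_outer iw ip s_def[symmetric] t_def[symmetric])
      (simp add: power2_eq_square algebra_simps)
  finally have "(norm (second_fundamental_form sphere_prod quad_map p w w))\<^sup>2 = (c * (s + 3 * t))\<^sup>2"
    by (simp add: power_mult_distrib)
  \<comment> \<open>This is the unit length of \<open>w\<close> in the pullback metric.\<close>
  moreover have "c\<^sup>2 * (s + 3 * t) = 1"
  proof -
    have "differential sphere_prod quad_map p w = quad_form p w + quad_form w p"
      unfolding eq by (rule differential_quadratic[OF bounded_bilinear_quad_form w])
    then have "1 = (norm (quad_form p w + quad_form w p))\<^sup>2" using nw by simp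
    also have "\<dots> = c\<^sup>2 * ((norm u)\<^sup>2 + 3 * (norm v)\<^sup>2)"
      using norm_quad_form_tangent[of x y u v] p w unfolding xy uv by blast
    finally show ?thesis
      unfolding s_def t_def power2_norm_eq_inner by simp
  qed
  then have "c * (s + 3 * t) = 1 / c"
    using c by (simp add: power2_eq_square field_simps)
  ultimately show ?thesis
    using c by (simp add: power2_eq_iff_nonneg)
qed

lemma max_normal_curvature_quad_map: "max_normal_curvature sphere_prod quad_map \<le> ennreal (1 / c)"
  unfolding max_normal_curvature_def
proof (rule SUP_least)
  fix pw :: "((real^'a) \<times> (real^'b)) \<times> ((real^'a) \<times> (real^'b))"
  assume *: "pw \<in> {(p, w). p \<in> sphere_prod \<and> w \<in> tangent_space sphere_prod p
    \<and> norm (differential sphere_prod quad_map p w) = 1}"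
  obtain p w where pw: "pw = (p, w)" by (metis surj_pair)
  from * show "(case pw of (p, w) \<Rightarrow> ennreal (norm (second_fundamental_form sphere_prod quad_map p w w)))
      \<le> ennreal (1 / c)"
    unfolding pw mem_Collect_eq split_conv using second_fundamental_form_quad_map[of p w] by simp
qed

end

section \<open>Dimension count and the resulting bound\<close>

theorem proposition8:
  fixes n1 n2 N :: nat
  assumes "n1 \<ge> n2" and "n2 \<ge> 1"
    and "N \<ge> (n1 + 1) * (n2 + 1) + n2 * (n2 + 3) div 2"
    and "CARD('a::finite) = n1 + 1" and "CARD('b::finite) = n2 + 1" and "CARD('n::finite) = N"
  shows "minimal_curvature TYPE('n) (sphere (0 :: real^'a) 1 \<times> sphere (0 :: real^'b) 1)
           \<le> ennreal (sqrt (real (2 * n2 + 1) / real (n2 + 1)))"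
proof -
  have "(n2 + 1) + ((n2 + 1) choose 2) = n2 * (n2 + 3) div 2 + 1"
  proof -
    \<comment> \<open>Both products are even, so the integer divisions are exact.\<close>
    have "(n2 + 1) * n2 div 2 * 2 = (n2 + 1) * n2" "n2 * (n2 + 3) div 2 * 2 = n2 * (n2 + 3)"
      by simp_all
    then show ?thesis
      unfolding choose_two by (simp add: algebra_simps)
  qed
  then have "CARD('a) * CARD('b) + (CARD('b) + (CARD('b) choose 2)) \<le> CARD('n) + 1"
    using assms(3-6) by simp
  then obtain L :: "(real^'b^'a) \<times> (real^'b^'b) \<Rightarrow> real^'n"
    where L: "linear L" "\<And>x. x \<in> UNIV \<times> sym_traceless \<Longrightarrow> norm (L x) = norm x"
    using obtain_isometry_sym_traceless by blast
  \<comment> \<open>The value for which the image lies on the unit sphere, with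
    \<open>CARD('b) = n2 + 1\<close>; its reciprocal is the claimed bound.\<close>
  define c where "c = sqrt (real (n2 + 1) / real (2 * n2 + 1))"
  have c: "c > 0" "c\<^sup>2 = real CARD('b) / real (2 * CARD('b) - 1)"
    by (simp_all add: c_def assms(5))
  have "minimal_curvature TYPE('n) (sphere (0 :: real^'a) 1 \<times> sphere (0 :: real^'b) 1)
      \<le> max_normal_curvature sphere_prod (quad_map L c)"
    unfolding minimal_curvature_def
    using smooth_immersion_quad_map[OF L c] norm_quad_map[OF L c]
    by (intro INF_lower) auto
  also have "\<dots> \<le> ennreal (1 / c)"
    by (rule max_normal_curvature_quad_map[OF L c])
  also have "1 / c = sqrt (real (2 * n2 + 1) / real (n2 + 1))"
    by (simp add: c_def real_sqrt_divide)
  finally show ?thesis .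
qed

end
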